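(* Let $n\in\mathbb N$ be even. Then the set $$G:=\{id\}\cup\{\sigma_1,\sigma_2\}\cup\{\gamma_i: i \text{ even},\ 4\le i\le n\}\cup\{\delta_i: i\text{ odd},\ 1\le i\le n-3\}$$ is the least generating set for $IF_n$; that is, $G$ generates the semigroup $IF_n$ and every generating set of $IF_n$ contains $G$.
   Context: $\mathbb N=\{1,2,3,\dots\}$. $X_n=\{1,\dots,n\}$ carries the fence (zigzag) partial order $1<_f 2>_f 3<_f\cdots<_f n$ (the only strict relations are between consecutive integers; odd numbers are minimal, even numbers are maximal). $I_n$ is the symmetric inverse semigroup of all partial injective maps on $X_n$; maps are written on the right and composed left to right. $IF_n$ is the inverse subsemigroup of all $\alpha\in I_n$ such that for all $x,y\in\mathrm{dom}\,\alpha$: $x<_f y$ if and only if $x\alpha<_f y\alpha$. Generation is as a semigroup. The elements of $G$ (for $n$ even) are: $id$, the identity map on $X_n$; $\sigma_1$ with domain $X_n\setminus\{2\}$: $1\sigma_1=n$ and $x\sigma_1=x-2$ for $3\le x\le n$; $\sigma_2=\sigma_1^{-1}$ with domain $X_n\setminus\{n-1\}$: $x\sigma_2=x+2$ for $1\le x\le n-2$ and $n\sigma_2=1$; $\gamma_i$ (for $i$ even, $4\le i\le n$) with domain $X_n\setminus\{i\}$: $x\gamma_i=i-x$ for $1\le x\le i-1$ and $x\gamma_i=x$ for $i+1\le x\le n$; $\delta_i$ (for $i$ odd, $1\le i\le n-3$) with domain $X_n\setminus\{i\}$: $x\delta_i=x$ for $1\le x\le i-1$ and $x\delta_i=n+i+1-x$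 for $i+1\le x\le n$. *)

theory Defs
  imports Main
begin

definition X :: "nat \<Rightarrow> nat set" where
  "X n = {1..n}"

text \<open>The strict fence order \<open>1 < 2 > 3 < 4 > \<dots>\<close>: consecutive integers are related,
  with the odd one below the even one.\<close>

definition fence_less :: "nat \<Rightarrow> nat \<Rightarrow> nat \<Rightarrow> bool" where
  "fence_less n x y \<longleftrightarrow> x \<in> X n \<and> y \<in> X n \<and> odd x \<and> (y = x + 1 \<or> x = y + 1)"

text \<open>Partial maps on \<open>X n\<close> are maps \<open>nat \<rightharpoonup> nat\<close> with domain and range inside \<open>X n\<close>.\<close>

definition sym_inv_semigroup :: "nat \<Rightarrow> (nat \<rightharpoonup> nat) set" where
  "sym_inv_semigroup n = {\<alpha>. dom \<alpha> \<subseteq> X n \<and> ran \<alpha> \<subseteq> X n \<and> inj_on \<alpha> (dom \<alpha>)}"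

definition IF :: "nat \<Rightarrow> (nat \<rightharpoonup> nat) set" where
  "IF n = {\<alpha> \<in> sym_inv_semigroup n.
     \<forall>x \<in> dom \<alpha>. \<forall>y \<in> dom \<alpha>. fence_less n x y \<longleftrightarrow> fence_less n (the (\<alpha> x)) (the (\<alpha> y))}"

text \<open>Left-to-right composition: first \<open>\<alpha>\<close>, then \<open>\<beta>\<close>.\<close>

definition pmult :: "(nat \<rightharpoonup> nat) \<Rightarrow> (nat \<rightharpoonup> nat) \<Rightarrow> (nat \<rightharpoonup> nat)" where
  "pmult \<alpha> \<beta> = \<beta> \<circ>\<^sub>m \<alpha>"

inductive_set semigroup_span :: "(nat \<rightharpoonup> nat) set \<Rightarrow> (nat \<rightharpoonup> nat) set"
  for A :: "(nat \<rightharpoonup> nat) set" where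
  gen: "\<alpha> \<in> A \<Longrightarrow> \<alpha> \<in> semigroup_span A"
| mult: "\<alpha> \<in> semigroup_span A \<Longrightarrow> \<beta> \<in> semigroup_span A \<Longrightarrow> pmult \<alpha> \<beta> \<in> semigroup_span A"

definition generating_set :: "(nat \<rightharpoonup> nat) set \<Rightarrow> (nat \<rightharpoonup> nat) set \<Rightarrow> bool" where
  "generating_set S A \<longleftrightarrow> A \<subseteq> S \<and> semigroup_span A = S"

definition least_generating_set :: "(nat \<rightharpoonup> nat) set \<Rightarrow> (nat \<rightharpoonup> nat) set \<Rightarrow> bool" where
  "least_generating_set S G \<longleftrightarrow>
     generating_set S G \<and> (\<forall>A. generating_set S A \<longrightarrow> G \<subseteq> A)"

definition idmap :: "nat \<Rightarrow> (nat \<rightharpoonup> nat)" where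
  "idmap n = (\<lambda>x. if x \<in> X n then Some x else None)"

definition sigma1 :: "nat \<Rightarrow> (nat \<rightharpoonup> nat)" where
  "sigma1 n = (\<lambda>x. if x = 1 then Some n
                   else if 3 \<le> x \<and> x \<le> n then Some (x - 2)
                   else None)"

definition sigma2 :: "nat \<Rightarrow> (nat \<rightharpoonup> nat)" where
  "sigma2 n = (\<lambda>x. if 1 \<le> x \<and> x + 2 \<le> n then Some (x + 2)
                   else if x = n then Some 1
                   else None)"

definition gamma :: "nat \<Rightarrow> nat \<Rightarrow> (nat \<rightharpoonup> nat)" where
  "gamma n i = (\<lambda>x. if 1 \<le> x \<and> x < i then Some (i - x)
                    else if i < x \<and> x \<le> n then Some x
                    else None)"

definition delta :: "nat \<Rightarrow> nat \<Rightarrow> (nat \<rightharpoonup> nat)" where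
  "delta n i = (\<lambda>x. if 1 \<le> x \<and> x < i then Some x
                    else if i < x \<and> x \<le> n then Some (n + i + 1 - x)
                    else None)"

text \<open>The bound \<open>i \<le> n - 3\<close> is written \<open>i + 3 \<le> n\<close> to avoid truncated subtraction.\<close>

definition G :: "nat \<Rightarrow> (nat \<rightharpoonup> nat) set" where
  "G n = {idmap n} \<union> {sigma1 n, sigma2 n}
       \<union> {gamma n i | i. even i \<and> 4 \<le> i \<and> i \<le> n}
       \<union> {delta n i | i. odd i \<and> 1 \<le> i \<and> i + 3 \<le> n}"

end

theory Submission
  imports Defs
begin

text \<open>
  Cut the domain of a map at its gaps, the points outside the domain, counting \<open>0\<close> and
  \<open>n + 1\<close> as gaps: a map in \<open>IF n\<close> carries the resulting blocks to the blocks of its range. Conjugating \<open>gamma\<close>'s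
  (or \<open>delta\<close>'s) by each other shows that the segment between any two gaps of the same parity may
  be reversed, and \<open>sigma2\<close> moves an isolated even point to position \<open>1\<close>. So one may assume
  that isolated points of domain and range are odd; then the map preserves parity. Reversals bring
  a block of the domain, and its image block, to the front, where the map can be made the identity;
  induct on the rest. The odd blocks that start right after a gap of the current parity have
  to be taken first: afterwards there is always a gap of the other parity in front of the next
  block, which allows an even block to be moved.

  Each generator other than the identity is the only one whose domain misses a given point. Hence
  an element of \<open>IF n\<close> whose domain misses one point is a generator or an idempotent, and
  no generator is a product of two other elements.
\<close>

definition pmap :: "(nat \<Rightarrow> nat) \<Rightarrow> nat set \<Rightarrow> (nat \<rightharpoonup> nat)" where
  "pmap f A = (\<lambda>x. if x \<in> A then Some (f x) else None)"

lemma pmult_pmap: "pmult (pmap f A) (pmap g B) = pmap (g \<circ> f) {x \<in> A. f x \<in> B}"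
  by (auto simp: pmult_def pmap_def map_comp_def fun_eq_iff)

lemma pmap_dom: "pmap (the \<circ> \<alpha>) (dom \<alpha>) = \<alpha>"
  by (auto simp: pmap_def fun_eq_iff dom_def)

lemma dom_pmap [simp]: "dom (pmap f A) = A"
  by (auto simp: pmap_def split: if_splits)

lemma ran_pmap [simp]: "ran (pmap f A) = f ` A"
  by (auto simp: pmap_def ran_def)

lemma inj_on_pmap: "inj_on (pmap f A) A \<longleftrightarrow> inj_on f A"
  by (auto simp: pmap_def inj_on_def)

lemma pmap_eq_iff: "pmap f A = pmap g B \<longleftrightarrow> A = B \<and> (\<forall>x\<in>A. f x = g x)"
  by (auto simp: pmap_def fun_eq_iff split: if_splits)

definition fiso :: "nat \<Rightarrow> nat set \<Rightarrow> (nat \<Rightarrow> nat) \<Rightarrow> bool" where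
  "fiso n D f \<longleftrightarrow> D \<subseteq> X n \<and> f ` D \<subseteq> X n \<and> inj_on f D \<and>
     (\<forall>x\<in>D. \<forall>y\<in>D. fence_less n x y \<longleftrightarrow> fence_less n (f x) (f y))"

lemma pmap_in_IF: "pmap f D \<in> IF n \<longleftrightarrow> fiso n D f"
  by (auto simp: IF_def sym_inv_semigroup_def fiso_def inj_on_pmap) (auto simp: pmap_def)

lemma fiso_comp: "fiso n D f \<Longrightarrow> fiso n (f ` D) g \<Longrightarrow> fiso n D (g \<circ> f)"
  by (auto simp: fiso_def image_comp intro: comp_inj_on)

lemma fiso_inv: "fiso n D f \<Longrightarrow> fiso n (f ` D) (inv_into D f)"
  by (auto simp: fiso_def inv_into_f_f inj_on_inv_into)

lemma fiso_subset: "fiso n D f \<Longrightarrow> E \<subseteq> D \<Longrightarrow> fiso n E f"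
  by (auto simp: fiso_def inj_on_def) blast+

lemma fiso_cong: "fiso n D f \<Longrightarrow> (\<And>x. x \<in> D \<Longrightarrow> f x = g x) \<Longrightarrow> fiso n D g"
  by (auto simp: fiso_def inj_on_def)

text \<open>Points of \<open>X n\<close> are consecutive exactly when they are comparable in one of
  the two directions, so forgetting the direction of the order leaves adjacency.\<close>

lemma fiso_adj:
  assumes "fiso n D f" "x \<in> D" "y \<in> D"
  shows "(x = y + 1 \<or> y = x + 1) \<longleftrightarrow> (f x = f y + 1 \<or> f y = f x + 1)"
proof -
  have *: "u = v + 1 \<or> v = u + 1 \<longleftrightarrow> fence_less n u v \<or> fence_less n v u"
    if "u \<in> X n" "v \<in> X n" for u v using that by (auto simp: fence_less_def)
  from assms have "x \<in> X n" "y \<in> X n" "f x \<in> X n" "f y \<in> X n" by (auto simp: fiso_def)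
  with assms show ?thesis by (simp only: *) (auto simp: fiso_def)
qed

lemma IF_mult:
  assumes "\<alpha> \<in> IF n" "\<beta> \<in> IF n" shows "pmult \<alpha> \<beta> \<in> IF n"
proof -
  define f where "f = the \<circ> \<alpha>" define g where "g = the \<circ> \<beta>"
  have \<alpha>: "\<alpha> = pmap f (dom \<alpha>)" and \<beta>: "\<beta> = pmap g (dom \<beta>)" by (simp_all add: f_def g_def pmap_dom)
  have fi: "fiso n (dom \<alpha>) f" "fiso n (dom \<beta>) g" using assms \<alpha> \<beta> pmap_in_IF by metis+
  let ?D = "{x \<in> dom \<alpha>. f x \<in> dom \<beta>}"
  have "fiso n ?D f" "fiso n (f ` ?D) g" using fi by (auto elim!: fiso_subset)
  then have "fiso n ?D (g \<circ> f)" by (rule fiso_comp)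
  then have "pmult (pmap f (dom \<alpha>)) (pmap g (dom \<beta>)) \<in> IF n" by (simp add: pmult_pmap pmap_in_IF)
  then show ?thesis using \<alpha> \<beta> by simp
qed

section \<open>Reversals of segments\<close>

text \<open>On its domain \<open>gamma n i\<close> is \<open>flip 0 i\<close> and
  \<open>delta n i\<close> is \<open>flip i (n + 1)\<close>. Fixing all other points makes this an
  involution of the natural numbers.\<close>

definition flip :: "nat \<Rightarrow> nat \<Rightarrow> nat \<Rightarrow> nat" where
  "flip a b x = (if a < x \<and> x < b then a + b - x else x)"

lemma flip_flip [simp]: "flip a b (flip a b x) = x"
  by (auto simp: flip_def)

lemma flip_eq_iff: "flip a b x = y \<longleftrightarrow> x = flip a b y"
  by (metis flip_flip)

lemma in_flip_image: "x \<in> flip a b ` D \<longleftrightarrow> flip a b x \<in> D"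
  by (auto simp: image_iff intro: bexI[of _ "flip a b x"])

lemma flip_parity: "even a = even b \<Longrightarrow> even (flip a b x) = even x"
  by (auto simp: flip_def)

lemma flip_end [simp]: "flip a b a = a" "flip a b b = b"
  by (simp_all add: flip_def)

text \<open>Consecutive points that avoid both ends are both inside or both outside the
  segment.\<close>

lemma flip_adj:
  assumes "x = y + 1" "x \<noteq> a" "x \<noteq> b" "y \<noteq> a" "y \<noteq> b"
  shows "flip a b x = flip a b y + 1 \<or> flip a b y = flip a b x + 1"
proof (cases "a < x \<and> x < b")
  case True
  then have "a < y \<and> y < b" "a + b - y = Suc (a + b - x)" using assms by linarith+
  with True show ?thesis unfolding flip_def by simp
next
  case False
  then have "\<not> (a < y \<and> y < b)" using assms by linarith
  then have "flip a b x = x" "flip a b y = y" using False by (auto simp: flip_def)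
  with assms(1) show ?thesis by simp
qed

text \<open>The order is determined by adjacency and parity. Parity survives because
  \<open>a + b\<close> is even, and \<open>b \<le> n + 1\<close> keeps the image inside
  \<open>X n\<close>.\<close>

lemma fiso_flip:
  assumes "D \<subseteq> X n" "a \<notin> D" "b \<notin> D" "even a = even b" "b \<le> n + 1"
  shows "fiso n D (flip a b)"
proof -
  have im: "flip a b x \<in> X n" if "x \<in> D" for x
    using assms that by (auto simp: flip_def X_def)
  have "fence_less n x y = fence_less n (flip a b x) (flip a b y)" if "x \<in> D" "y \<in> D" for x y
  proof -
    have "x \<noteq> a" "x \<noteq> b" "y \<noteq> a" "y \<noteq> b" using that assms by auto
    \<comment> \<open>The converse direction is \<open>flip_adj\<close> applied to the images, as a
      flip is its own inverse.\<close>
    then have "(y = x + 1 \<or> x = y + 1) = (flip a b y = flip a b x + 1 \<or> flip a b x = flip a b y + 1)"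
      using flip_adj[of x y a b] flip_adj[of y x a b] flip_adj[of "flip a b x" "flip a b y" a b]
        flip_adj[of "flip a b y" "flip a b x" a b] by (auto simp: flip_eq_iff)
    then show ?thesis using im that assms(1) by (auto simp: fence_less_def flip_parity[OF assms(4)])
  qed
  then show ?thesis using im assms(1) by (auto simp: fiso_def inj_on_def flip_eq_iff)
qed

section \<open>The generators as one family indexed by the missing point\<close>

locale even_fence =
  fixes n :: nat
  assumes n: "n \<ge> 1" "even n"
begin

text \<open>\<open>gen_fun i\<close> describes the generator whose domain misses exactly \<open>i\<close>; its inverse is the
  generator for \<open>partner i\<close>.\<close>

definition gen_fun :: "nat \<Rightarrow> nat \<Rightarrow> nat" where
  "gen_fun i = (if i = 2 then (\<lambda>x. if x = 1 then n else x - 2)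
                else if i = n - 1 then (\<lambda>x. if x = n then 1 else x + 2)
                else if even i then flip 0 i else flip i (n + 1))"

definition partner :: "nat \<Rightarrow> nat" where
  "partner i = (if i = 2 then n - 1 else if i = n - 1 then 2 else i)"

abbreviation gen :: "nat \<Rightarrow> (nat \<rightharpoonup> nat)" where
  "gen i \<equiv> pmap (gen_fun i) (X n - {i})"

abbreviation idem :: "nat \<Rightarrow> (nat \<rightharpoonup> nat)" where
  "idem i \<equiv> pmap id (X n - {i})"

abbreviation generated :: "(nat \<Rightarrow> nat) \<Rightarrow> nat set \<Rightarrow> bool" where
  "generated f D \<equiv> pmap f D \<in> semigroup_span (G n)"

lemma n2: "n \<ge> 2" using n by presburger

lemma idmap_pmap: "idmap n = pmap id (X n)"
  by (simp add: idmap_def pmap_def fun_eq_iff)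

lemma sigma1_gen: "sigma1 n = gen 2"
  using n2 by (auto simp: sigma1_def pmap_def gen_fun_def X_def fun_eq_iff)

lemma sigma2_gen: "sigma2 n = gen (n - 1)"
proof -
  \<comment> \<open>By parity; hence the test \<open>i = 2\<close> in \<open>gen_fun\<close> does
    not catch \<open>n - 1\<close>.\<close>
  have "n - 1 \<noteq> 2" using n by presburger
  then show ?thesis using n2 by (auto simp: sigma2_def pmap_def gen_fun_def X_def fun_eq_iff)
qed

lemma gamma_gen: "even i \<Longrightarrow> 4 \<le> i \<Longrightarrow> i \<le> n \<Longrightarrow> gamma n i = gen i"
proof -
  assume i: "even i" "4 \<le> i" "i \<le> n"
  then have "i \<noteq> n - 1" using n by presburger
  then show ?thesis using i by (auto simp: gamma_def pmap_def gen_fun_def X_def flip_def fun_eq_iff)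
qed

lemma delta_gen: "odd i \<Longrightarrow> 1 \<le> i \<Longrightarrow> i + 3 \<le> n \<Longrightarrow> delta n i = gen i"
  by (auto simp: delta_def pmap_def gen_fun_def X_def flip_def fun_eq_iff)

text \<open>An even point of \<open>X n\<close> is \<open>2\<close> or at least \<open>4\<close>, an
  odd one is \<open>n - 1\<close> or at most \<open>n - 3\<close>, so every point is the missing
  point of a listed generator.\<close>

lemma G_gen: "G n = insert (pmap id (X n)) (gen ` X n)"
proof -
  let ?E = "{i. even i \<and> 4 \<le> i \<and> i \<le> n}" and ?O = "{i. odd i \<and> 1 \<le> i \<and> i + 3 \<le> n}"
  obtain m where m: "n = 2 * m" using n by blast
  have "i \<in> X n \<longleftrightarrow> i \<in> {2, n - 1} \<union> ?E \<union> ?O" for i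
  proof (cases "even i")
    case True
    then obtain j where "i = 2 * j" by blast
    then show ?thesis using m n by (simp add: X_def) arith
  next
    case False
    then obtain j where "i = 2 * j + 1" by (rule oddE)
    then show ?thesis using m n by (simp add: X_def) arith
  qed
  then have X: "X n = {2, n - 1} \<union> ?E \<union> ?O" by blast
  have E: "{gamma n i |i. even i \<and> 4 \<le> i \<and> i \<le> n} = gen ` ?E"
    by (simp add: setcompr_eq_image gamma_gen cong: image_cong_simp)
  have O: "{delta n i |i. odd i \<and> 1 \<le> i \<and> i + 3 \<le> n} = gen ` ?O"
    by (simp add: setcompr_eq_image delta_gen cong: image_cong_simp)
  have "gen ` X n = {gen 2, gen (n - 1)} \<union> gen ` ?E \<union> gen ` ?O"
    unfolding X image_Un image_insert image_empty ..
  then show ?thesis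
    unfolding G_def idmap_pmap sigma1_gen sigma2_gen E O by (simp add: insert_commute)
qed

lemma partner_in: "i \<in> X n \<Longrightarrow> partner i \<in> X n"
  using n2 by (auto simp: partner_def X_def)

lemma partner_partner [simp]: "partner (partner i) = i"
  by (simp add: partner_def)

lemma gen_fun_image:
  assumes "i \<in> X n" "x \<in> X n - {i}" shows "gen_fun i x \<in> X n - {partner i}"
proof -
  have n12: "n - 1 \<noteq> 2" using n by presburger
  consider "i = 2" | "i = n - 1" | "i \<noteq> 2" "i \<noteq> n - 1" by auto
  then show ?thesis
  proof cases
    case 1
    have "x = 1 \<or> x \<ge> 3" using assms 1 by (auto simp: X_def)
    then show ?thesis using 1 assms n2 by (auto simp: gen_fun_def partner_def X_def)
  next
    case 2
    have "x = n \<or> x + 2 \<le> n" using assms 2 by (auto simp: X_def)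
    then show ?thesis using 2 assms n2 n12 by (auto simp: gen_fun_def partner_def X_def)
  next
    case 3
    then show ?thesis using assms by (auto simp: gen_fun_def partner_def X_def flip_def)
  qed
qed

lemma gen_fun_partner:
  assumes "i \<in> X n" "x \<in> X n - {i}" shows "gen_fun (partner i) (gen_fun i x) = x"
proof -
  have n12: "n - 1 \<noteq> 2" using n by presburger
  show ?thesis
  proof (cases "i = 2 \<or> i = n - 1")
    case True
    then show ?thesis using assms n2 n12 by (auto simp: gen_fun_def partner_def X_def)
  next
    case False
    then show ?thesis by (simp add: gen_fun_def partner_def)
  qed
qed

text \<open>Separates \<open>gen i\<close> from the idempotent \<open>idem i\<close> with the same
  domain; one of the end points \<open>1\<close> and \<open>n\<close> is always moved.\<close>

lemma gen_fun_not_id: "i \<in> X n \<Longrightarrow> \<exists>x\<in>X n - {i}. gen_fun i x \<noteq> x"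
proof -
  assume i: "i \<in> X n"
  consider "i = 2" | "i = n - 1" | "even i" "i \<noteq> 2" "i \<noteq> n - 1" | "odd i" "i \<noteq> n - 1" by auto
  then show ?thesis
  proof cases
    case 1 then show ?thesis using n n2 by (intro bexI[of _ 1]) (auto simp: gen_fun_def X_def)
  next
    case 2
    moreover have "n - 1 \<noteq> 2" using n by presburger
    ultimately show ?thesis using n n2 by (intro bexI[of _ n]) (auto simp: gen_fun_def X_def)
  next
    case 3
    then have "i \<ge> 4" using i by (auto simp: X_def)
    with 3 i show ?thesis by (intro bexI[of _ 1]) (auto simp: gen_fun_def X_def flip_def)
  next
    case 4
    then have "i + 3 \<le> n" using i n by (auto simp: X_def) presburger
    with 4 i show ?thesis by (intro bexI[of _ n]) (auto simp: gen_fun_def X_def flip_def)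
  qed
qed

text \<open>Away from \<open>1\<close> this is a shift by two. The point \<open>1\<close> changes
  parity, but it is isolated once \<open>2\<close> is missing, as is its image \<open>n\<close> once
  \<open>n - 1\<close> is missing.\<close>

lemma fiso_gen_2: "fiso n (X n - {2}) (gen_fun 2)"
proof -
  have 2: "2 \<in> X n" using n2 by (simp add: X_def)
  have "fence_less n x y = fence_less n (gen_fun 2 x) (gen_fun 2 y)"
    if x: "x \<in> X n - {2}" and y: "y \<in> X n - {2}" for x y
  proof -
    have g1: "gen_fun 2 (Suc 0) = n" and g: "gen_fun 2 (u + 2) = u" "gen_fun 2 (Suc (Suc u)) = u" if "u \<ge> 1" for u
      using that by (simp_all add: gen_fun_def)
    have c: "z = 1 \<or> (\<exists>u\<ge>1. z = u + 2)" if "z \<in> X n - {2}" for z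
      using that by (cases "z = 1") (auto simp: X_def intro!: exI[of _ "z - 2"])
    from c[OF x] c[OF y] show ?thesis
    proof (elim disjE exE conjE)
      fix u v assume uv: "u \<ge> 1" "x = u + 2" "v \<ge> 1" "y = v + 2"
      then show ?thesis using x y unfolding uv(2,4) g(1)[OF uv(1)] g(1)[OF uv(3)]
        by (auto simp: fence_less_def X_def)
    qed (use x y n in \<open>auto simp: g g1 fence_less_def X_def\<close>)
  qed
  moreover have "inj_on (gen_fun 2) (X n - {2})"
    using gen_fun_partner[OF 2] by (rule inj_on_inverseI)
  ultimately show ?thesis using gen_fun_image[OF 2] unfolding fiso_def by blast
qed

lemma fiso_gen:
  assumes i: "i \<in> X n" shows "fiso n (X n - {i}) (gen_fun i)"
proof -
  have n12: "n - 1 \<noteq> 2" using n by presburger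
  consider "i = 2" | "i = n - 1" | "even i" "i \<noteq> 2" "i \<noteq> n - 1" | "odd i" "i \<noteq> n - 1" by auto
  then show ?thesis
  proof cases
    case 1 then show ?thesis using fiso_gen_2 by simp
  next
    case 2
    \<comment> \<open>\<open>gen (n - 1)\<close> is the inverse of \<open>gen 2\<close>, so
      \<open>fiso_inv\<close> transfers the previous lemma to it.\<close>
    have 22: "2 \<in> X n" using n2 by (simp add: X_def)
    have p: "partner 2 = i" "partner i = 2" using n12 2 by (simp_all add: partner_def)
    have im: "gen_fun 2 ` (X n - {2}) = X n - {i}"
    proof
      show "gen_fun 2 ` (X n - {2}) \<subseteq> X n - {i}" using gen_fun_image[OF 22] p by auto
      show "X n - {i} \<subseteq> gen_fun 2 ` (X n - {2})"
        using gen_fun_image[OF i] gen_fun_partner[OF i] p by (metis image_eqI subsetI)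
    qed
    have "inj_on (gen_fun 2) (X n - {2})" using fiso_gen_2 by (simp add: fiso_def)
    then have "inv_into (X n - {2}) (gen_fun 2) y = gen_fun i y" if "y \<in> X n - {i}" for y
      using inv_into_f_eq gen_fun_image[OF i that] gen_fun_partner[OF i that] p by metis
    with fiso_inv[OF fiso_gen_2] show ?thesis unfolding im by (rule fiso_cong)
  next
    case 3
    then have "gen_fun i = flip 0 i" by (auto simp: gen_fun_def)
    with 3 i show ?thesis by (auto intro!: fiso_flip simp: X_def)
  next
    case 4
    then have "gen_fun i = flip i (n + 1)" by (auto simp: gen_fun_def)
    with 4 i n show ?thesis by (auto intro!: fiso_flip simp: X_def)
  qed
qed

lemma G_subset: "G n \<subseteq> IF n"
proof -
  have "fiso n (X n) id" by (simp add: fiso_def)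
  then show ?thesis unfolding G_gen using fiso_gen by (simp add: pmap_in_IF image_subset_iff)
qed

section \<open>Closure properties of the semigroup generated by \<open>G n\<close>\<close>

lemma span_subset:
  assumes "A \<subseteq> IF n" shows "semigroup_span A \<subseteq> IF n"
proof
  fix \<alpha> assume "\<alpha> \<in> semigroup_span A"
  then show "\<alpha> \<in> IF n" by induction (use assms IF_mult in auto)
qed

lemma generated_fiso: "generated f D \<Longrightarrow> fiso n D f"
  unfolding pmap_in_IF[symmetric] by (rule subsetD[OF span_subset[OF G_subset]])

lemma generated_comp:
  assumes "generated f D" "generated g (f ` D)" shows "generated (g \<circ> f) D"
proof -
  have "{x \<in> D. f x \<in> f ` D} = D" by auto
  with semigroup_span.mult[OF assms] show ?thesis by (simp only: pmult_pmap)
qed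

lemma generated_cong: "generated f D \<Longrightarrow> (\<And>x. x \<in> D \<Longrightarrow> f x = g x) \<Longrightarrow> generated g D"
  using pmap_eq_iff[of f D g D] by simp

lemma idem_eq: "i \<in> X n \<Longrightarrow> pmult (gen i) (gen (partner i)) = idem i"
  using gen_fun_image gen_fun_partner by (auto simp: pmult_pmap pmap_eq_iff)

lemma generated_gen: "i \<in> X n \<Longrightarrow> generated (gen_fun i) (X n - {i})"
  by (auto intro!: semigroup_span.gen simp: G_gen)

text \<open>A partial identity is the product of \<open>idmap n\<close> and the idempotents
  \<open>idem i\<close> over its missing points, and each \<open>idem i\<close> is a generator times
  its inverse.\<close>

lemma generated_id:
  assumes "D \<subseteq> X n" shows "generated id D"
proof -
  have "generated id (X n - F)" if "finite F" "F \<subseteq> X n" for F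
    using that
  proof induction
    case empty
    have "pmap id (X n) \<in> G n" unfolding G_gen by (rule insertI1)
    then show ?case by (simp only: Diff_empty semigroup_span.gen)
  next
    case (insert i F)
    then have i: "i \<in> X n" and F: "generated id (X n - F)" by blast+
    have "idem i \<in> semigroup_span (G n)"
      unfolding idem_eq[OF i, symmetric] using i partner_in[OF i]
      by (intro semigroup_span.mult generated_gen)
    from this F have "pmult (idem i) (pmap id (X n - F)) \<in> semigroup_span (G n)" by (rule semigroup_span.mult)
    moreover have "{x \<in> X n - {i}. id x \<in> X n - F} = X n - insert i F" by auto
    ultimately show ?case unfolding pmult_pmap by (simp only: id_comp)
  qed
  from this[of "X n - D"] assms show ?thesis
    by (simp add: X_def double_diff)
qed

text \<open>Multiplying on the left by a partial identity restricts the domain.\<close>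

lemma generated_subset:
  assumes "generated f D" "E \<subseteq> D" shows "generated f E"
proof -
  have "generated id E" using generated_id generated_fiso[OF assms(1)] assms(2) by (auto simp: fiso_def)
  then have "pmult (pmap id E) (pmap f D) \<in> semigroup_span (G n)"
    using assms(1) by (rule semigroup_span.mult)
  moreover have "{x \<in> E. id x \<in> D} = E" using assms by auto
  ultimately show ?thesis by (simp add: pmult_pmap)
qed

text \<open>The generators are closed under inversion through \<open>partner\<close>, and a product
  is inverted by reversing the inverted factors.\<close>

lemma span_inverse: "\<alpha> \<in> semigroup_span (G n) \<Longrightarrow>
  \<exists>\<beta>\<in>semigroup_span (G n). \<forall>x y. \<alpha> x = Some y \<longleftrightarrow> \<beta> y = Some x"
proof (induction rule: semigroup_span.induct)
  case (gen \<alpha>)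
  then consider "\<alpha> = pmap id (X n)" | i where "i \<in> X n" "\<alpha> = gen i" by (auto simp: G_gen)
  then show ?case
  proof cases
    case 1 with gen show ?thesis
      by (intro bexI[of _ \<alpha>] semigroup_span.gen) (auto simp: pmap_def split: if_splits)
  next
    case 2
    have "\<alpha> x = Some y \<longleftrightarrow> gen (partner i) y = Some x" for x y
      using gen_fun_image[of i x] gen_fun_image[of "partner i" y]
        gen_fun_partner[of i x] gen_fun_partner[of "partner i" y] 2 partner_in[of i]
      by (auto simp: pmap_def split: if_splits)
    then show ?thesis using generated_gen[OF partner_in] 2(1) by blast
  qed
next
  case (mult \<alpha> \<beta>)
  then obtain \<alpha>' \<beta>' where *: "\<alpha>' \<in> semigroup_span (G n)" "\<beta>' \<in> semigroup_span (G n)"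
    "\<forall>x y. \<alpha> x = Some y \<longleftrightarrow> \<alpha>' y = Some x" "\<forall>x y. \<beta> x = Some y \<longleftrightarrow> \<beta>' y = Some x" by blast
  then have "\<forall>x y. pmult \<alpha> \<beta> x = Some y \<longleftrightarrow> pmult \<beta>' \<alpha>' y = Some x"
    by (auto simp: pmult_def map_comp_Some_iff)
  with * show ?case by (blast intro: semigroup_span.mult)
qed

lemma generated_inv:
  assumes "generated f D" shows "generated (inv_into D f) (f ` D)"
proof -
  obtain \<beta> where \<beta>: "\<beta> \<in> semigroup_span (G n)" "\<And>x y. pmap f D x = Some y \<longleftrightarrow> \<beta> y = Some x"
    using span_inverse[OF assms] by blast
  have inj: "inj_on f D" using generated_fiso[OF assms] by (simp add: fiso_def)
  have "\<beta> y = pmap (inv_into D f) (f ` D) y" for y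
  proof (cases "y \<in> f ` D")
    case True
    then obtain x where x: "x \<in> D" "y = f x" by blast
    then have "\<beta> y = Some x" using \<beta>(2)[of x y] by (simp add: pmap_def)
    with x inj show ?thesis by (simp add: pmap_def)
  next
    case False
    have "\<beta> y \<noteq> Some x" for x
      using \<beta>(2)[of x y] False by (auto simp: pmap_def split: if_splits)
    then have "\<beta> y = None" by blast
    with False show ?thesis by (simp add: pmap_def)
  qed
  then have "\<beta> = pmap (inv_into D f) (f ` D)" by (rule ext)
  with \<beta>(1) show ?thesis by (simp only:)
qed

text \<open>Domain and range can be normalised independently: \<open>f\<close> is recovered from the
  normalised map by applying \<open>g\<close> before it and the inverse of \<open>h\<close> after
  it.\<close>

lemma generated_conj:
  assumes "generated g D" "generated h (f ` D)" "generated (h \<circ> f \<circ> inv_into D g) (g ` D)"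
  shows "generated f D"
proof -
  let ?k = "h \<circ> f \<circ> inv_into D g"
  have inj: "inj_on g D" "inj_on h (f ` D)" using assms(1,2) generated_fiso by (auto simp: fiso_def)
  have k: "?k (g x) = h (f x)" if "x \<in> D" for x using inj(1) that by simp
  have im: "(?k \<circ> g) ` D = h ` f ` D"
    unfolding image_image by (rule image_cong) (simp_all add: k[unfolded o_def])
  have "generated (inv_into (f ` D) h \<circ> (?k \<circ> g)) D"
    by (rule generated_comp[OF generated_comp[OF assms(1,3)]]) (simp only: im generated_inv[OF assms(2)])
  then show ?thesis
  proof (rule generated_cong)
    fix x assume x: "x \<in> D"
    then have "(inv_into (f ` D) h \<circ> (?k \<circ> g)) x = inv_into (f ` D) h (h (f x))"
      using k[OF x] by simp
    also have "\<dots> = f x" using inj(2) x by simp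
    finally show "(inv_into (f ` D) h \<circ> (?k \<circ> g)) x = f x" .
  qed
qed

section \<open>Generating all segment reversals\<close>

lemma generated_flip_0:
  assumes "D \<subseteq> X n" "b \<notin> D" "even b" "0 < b" "b \<le> n"
  shows "generated (flip 0 b) D"
proof (cases "b = 2")
  case True
  \<comment> \<open>The segment between \<open>0\<close> and \<open>2\<close> is the single point
    \<open>1\<close>, so the flip is the identity; \<open>gen_fun 2\<close> is not a flip.\<close>
  show ?thesis
    by (rule generated_cong[OF generated_id[OF assms(1)]]) (use True in \<open>auto simp: flip_def\<close>)
next
  case False
  have "b \<noteq> n - 1" using assms n by presburger
  then have "gen_fun b = flip 0 b" using assms False by (auto simp: gen_fun_def)
  then show ?thesis using generated_subset[OF generated_gen[of b], of D] assms by (auto simp: X_def)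
qed

lemma generated_flip_n:
  assumes "D \<subseteq> X n" "a \<notin> D" "odd a" "a \<le> n"
  shows "generated (flip a (n + 1)) D"
proof (cases "a = n - 1")
  case True
  \<comment> \<open>Likewise the segment between \<open>n - 1\<close> and \<open>n + 1\<close> is
    the single point \<open>n\<close>.\<close>
  show ?thesis
    by (rule generated_cong[OF generated_id[OF assms(1)]])
      (use True assms in \<open>auto simp: flip_def X_def\<close>)
next
  case False
  then have "gen_fun a = flip a (n + 1)" using assms by (auto simp: gen_fun_def)
  then show ?thesis using generated_subset[OF generated_gen[of a], of D] assms
    by (auto simp: X_def odd_pos Suc_leI)
qed

lemma generated_flip:
  assumes D: "D \<subseteq> X n" and ab: "a \<notin> D" "b \<notin> D" "even a = even b" "a < b" "b \<le> n + 1"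
  shows "generated (flip a b) D"
proof -
  have flipX: "flip c d ` E \<subseteq> X n" if "E \<subseteq> X n" "d \<le> n + 1" for c d E
    using that by (auto simp: flip_def X_def)
  consider "even b" "a = 0" | "even b" "a > 0" | "odd b" "b = n + 1" | "odd b" "b \<le> n"
    using ab by linarith
  then show ?thesis
  proof cases
    case 1
    then have "b \<le> n" using ab n by presburger
    then show ?thesis using D ab 1 by (auto intro: generated_flip_0)
  next
    case 2
    \<comment> \<open>\<open>?f\<close> carries the segment between \<open>a\<close> and
      \<open>b\<close> to the one between \<open>0\<close> and \<open>b - a\<close>,
      \<open>?g\<close> reverses it there, and \<open>?f\<close> carries it back.\<close>
    let ?f = "flip 0 b" let ?g = "flip 0 (b - a)"
    have b: "b \<le> n" using 2 ab n by presburger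
    have m1: "flip 0 b (b - a) = a" using ab 2 by (simp add: flip_def)
    have m2: "flip 0 (b - a) b = b" by (auto simp: flip_def)
    have m3: "flip 0 b b = b" by (simp add: flip_def)
    have p: "even (b - a)" "0 < b - a" "b - a \<le> n" "0 < b" "b - a \<le> n + 1" using 2 ab b by auto
    have g1: "generated ?f D" by (rule generated_flip_0[OF D ab(2) 2(1) p(4) b])
    have g2: "generated ?g (?f ` D)"
      by (rule generated_flip_0[OF flipX[OF D ab(5)] _ p(1-3)]) (simp add: in_flip_image m1 ab)
    have g3: "generated ?f (?g ` ?f ` D)"
      by (rule generated_flip_0[OF flipX[OF flipX[OF D ab(5)] p(5)] _ 2(1) p(4) b])
        (simp add: in_flip_image m2 m3 ab)
    have "generated (?f \<circ> (?g \<circ> ?f)) D"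
      by (rule generated_comp[OF generated_comp[OF g1 g2]]) (simp only: image_comp[symmetric] g3)
    then show ?thesis
      by (rule generated_cong) (use ab 2 in \<open>auto simp: flip_def\<close>)
  next
    case 3
    then show ?thesis using generated_flip_n[OF D, of a] ab by simp
  next
    case 4
    \<comment> \<open>The mirror image of the even case: the segment is carried to the right end,
      between \<open>?c\<close> and \<open>n + 1\<close>.\<close>
    let ?f = "flip a (n + 1)" let ?c = "n + 1 + a - b" let ?g = "flip ?c (n + 1)"
    have m1: "flip a (n + 1) ?c = b" using ab 4 by (auto simp: flip_def)
    have m2: "flip ?c (n + 1) a = a" using ab 4 by (simp add: flip_def)
    have m3: "flip a (n + 1) a = a" by (simp add: flip_def)
    have p: "odd a" "a \<le> n" "odd ?c" "?c \<le> n" using 4 ab n by auto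
    have g1: "generated ?f D" by (rule generated_flip_n[OF D ab(1) p(1,2)])
    have g2: "generated ?g (?f ` D)"
      by (rule generated_flip_n[OF flipX[OF D order_refl] _ p(3,4)]) (simp only: in_flip_image m1 ab not_False_eq_True)
    have g3: "generated ?f (?g ` ?f ` D)"
      by (rule generated_flip_n[OF flipX[OF flipX[OF D order_refl] order_refl] _ p(1,2)])
        (simp only: in_flip_image m2 m3 ab not_False_eq_True)
    have "generated (?f \<circ> (?g \<circ> ?f)) D"
      by (rule generated_comp[OF generated_comp[OF g1 g2]]) (simp only: image_comp[symmetric] g3)
    then show ?thesis
      by (rule generated_cong) (use ab 4 in \<open>auto simp: flip_def\<close>)
  qed
qed

section \<open>Maps that are settled up to a gap\<close>

text \<open>The invariant of the induction on the gap \<open>k\<close>: everything before it is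
  finished. Parity is included because reversals need ends of equal parity.\<close>

definition pinned :: "nat \<Rightarrow> nat set \<Rightarrow> (nat \<Rightarrow> nat) \<Rightarrow> bool" where
  "pinned k D f \<longleftrightarrow> fiso n D f \<and> k \<notin> D \<and>
     (\<forall>x\<in>D. even (f x) = even x \<and> (x \<le> k \<longrightarrow> f x = x) \<and> (k < x \<longrightarrow> k < f x))"

lemma pinnedI:
  assumes "fiso n D f" "k \<notin> D" "\<And>x. x \<in> D \<Longrightarrow> even (f x) = even x"
    "\<And>x. x \<in> D \<Longrightarrow> x \<le> k \<Longrightarrow> f x = x" "\<And>x. x \<in> D \<Longrightarrow> k < x \<Longrightarrow> k < f x"
  shows "pinned k D f"
  unfolding pinned_def using assms by blast

lemma pinnedD:
  assumes "pinned k D f"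
  shows "fiso n D f" "k \<notin> D" "\<And>x. x \<in> D \<Longrightarrow> even (f x) = even x"
    "\<And>x. x \<in> D \<Longrightarrow> x \<le> k \<Longrightarrow> f x = x" "\<And>x. x \<in> D \<Longrightarrow> k < x \<Longrightarrow> k < f x"
  using assms by (simp_all add: pinned_def)

lemma pinned_comp:
  assumes f: "pinned k D f" and g: "pinned k (f ` D) g" shows "pinned k D (g \<circ> f)"
proof (rule pinnedI)
  show "fiso n D (g \<circ> f)" using f g by (intro fiso_comp pinnedD)
  show "k \<notin> D" by (rule pinnedD(2)[OF f])
  fix x assume x: "x \<in> D"
  note F = pinnedD(3-)[OF f x] and G = pinnedD(3-)[OF g imageI[OF x]]
  show "even ((g \<circ> f) x) = even x" using F(1) G(1) by simp
  show "(g \<circ> f) x = x" if "x \<le> k" using F(2) G(2) that by simp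
  show "k < (g \<circ> f) x" if "k < x" using F(3) G(3) that by simp
qed

lemma pinned_image: "pinned k D f \<Longrightarrow> k \<notin> f ` D"
  by (auto simp: pinned_def)

lemma pinned_inv:
  assumes f: "pinned k D f" shows "pinned k (f ` D) (inv_into D f)"
proof (rule pinnedI)
  show "fiso n (f ` D) (inv_into D f)" by (rule fiso_inv[OF pinnedD(1)[OF f]])
  show "k \<notin> f ` D" by (rule pinned_image[OF f])
  fix y assume "y \<in> f ` D"
  then obtain x where x: "x \<in> D" "y = f x" by blast
  have "inj_on f D" using pinnedD(1)[OF f] by (simp add: fiso_def)
  then have y: "inv_into D f (f x) = x" using x by simp
  note F = pinnedD(3-)[OF f x(1)]
  show "even (inv_into D f y) = even y" unfolding x(2) y using F(1) by simp
  show "inv_into D f y = y" if "y \<le> k"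
  proof -
    have "x \<le> k" using F(3) that unfolding x(2) by linarith
    then show ?thesis unfolding x(2) y using F(2) by simp
  qed
  show "k < inv_into D f y" if "k < y"
  proof (rule ccontr)
    assume "\<not> k < inv_into D f y"
    then have "x \<le> k" unfolding x(2) y by simp
    then show False using F(2) that unfolding x(2) by simp
  qed
qed

lemma pinned_flip:
  assumes "D \<subseteq> X n" "a \<notin> D" "b \<notin> D" "even a = even b" "b \<le> n + 1" "k \<le> a" "k \<notin> D"
  shows "pinned k D (flip a b)"
proof -
  have "x \<le> k \<Longrightarrow> flip a b x = x" "k < x \<Longrightarrow> k < flip a b x" for x
    using assms(6) by (auto simp: flip_def)
  then show ?thesis using assms fiso_flip[of D n a b] by (simp add: pinned_def flip_parity)
qed

section \<open>Blocks, their images, and moving them to the front\<close>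

text \<open>A maximal run of consecutive points, recorded by its bounding gaps. Its size is
  \<open>b - a - 1\<close>, so \<open>even (b - a)\<close> marks a block of odd size, whose two gaps
  have equal parity.\<close>

definition block :: "nat set \<Rightarrow> nat \<Rightarrow> nat \<Rightarrow> bool" where
  "block D a b \<longleftrightarrow> a + 1 < b \<and> a \<notin> D \<and> b \<notin> D \<and> {a<..<b} \<subseteq> D"

lemma block_le:
  assumes "D \<subseteq> X n" "block D a b" shows "b \<le> n + 1"
proof -
  have "b - 1 \<in> {a<..<b}" "{a<..<b} \<subseteq> D" using assms by (auto simp: block_def)
  then have "b - 1 \<in> X n" using assms(1) by blast
  then show ?thesis by (auto simp: X_def)
qed

text \<open>The ends are the gaps nearest to \<open>x\<close>; they exist because \<open>k\<close>
  is a gap below \<open>x\<close> and \<open>n + 1\<close> is one above it.\<close>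

lemma ex_block:
  assumes D: "D \<subseteq> X n" and x: "x \<in> D" and k: "k \<notin> D" "k < x"
  shows "\<exists>a b. block D a b \<and> k \<le> a \<and> a < x \<and> x < b"
proof -
  let ?A = "{y. y < x \<and> y \<notin> D}"
  define a where "a = Max ?A"
  have fin: "finite ?A" and kA: "k \<in> ?A" using k by auto
  have a: "a \<in> ?A" using Max_in[OF fin] kA unfolding a_def by blast
  have amax: "y \<le> a" if "y < x" "y \<notin> D" for y
    unfolding a_def by (rule Max_ge[OF fin]) (use that in blast)
  define b where "b = (LEAST y. x < y \<and> y \<notin> D)"
  have "x < n + 1 \<and> n + 1 \<notin> D" using D x by (auto simp: X_def)
  then have b: "x < b \<and> b \<notin> D" unfolding b_def by (rule LeastI)
  have bmin: "b \<le> y" if "x < y" "y \<notin> D" for y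
    unfolding b_def by (rule Least_le) (use that in blast)
  have "y \<in> D" if "a < y" "y < b" for y
  proof (cases y x rule: linorder_cases)
    case less then show ?thesis using amax[of y] that by auto
  next
    case equal then show ?thesis using x by simp
  next
    case greater then show ?thesis using bmin[of y] that by auto
  qed
  then have "block D a b" using a b by (auto simp: block_def)
  then show ?thesis using a b amax[of k] k by auto
qed

text \<open>A walk with unit steps that never repeats a value cannot turn round. The descending case
  is written with sums to avoid truncated subtraction.\<close>

lemma walk:
  fixes f :: "nat \<Rightarrow> nat"
  assumes "\<And>i. i < m \<Longrightarrow> f (p + Suc i) = f (p + i) + 1 \<or> f (p + i) = f (p + Suc i) + 1"
    and "inj_on f {p..p + m}"
  shows "(\<forall>i\<le>m. f (p + i) = f p + i) \<or> (\<forall>i\<le>m. f (p + i) + i = f p)"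
  using assms
proof (induction m)
  case 0 then show ?case by simp
next
  case (Suc m)
  have IH: "(\<forall>i\<le>m. f (p + i) = f p + i) \<or> (\<forall>i\<le>m. f (p + i) + i = f p)"
    using Suc.prems by (intro Suc.IH) (auto intro: inj_on_subset)
  have step: "f (p + Suc m) = f (p + m) + 1 \<or> f (p + m) = f (p + Suc m) + 1"
    using Suc.prems(1)[of m] by simp
  show ?case
  proof (cases m)
    case 0 then show ?thesis using step by (auto simp: le_Suc_eq)
  next
    case (Suc j)
    \<comment> \<open>A turn at \<open>p + m\<close> would repeat the value taken at its predecessor
      \<open>p + j\<close>.\<close>
    have "p + Suc m \<noteq> p + j" using Suc by simp
    then have ne: "f (p + Suc m) \<noteq> f (p + j)"
      using inj_onD[OF Suc.prems(2), of "p + Suc m" "p + j"] Suc by auto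
    from IH show ?thesis
    proof
      assume up: "\<forall>i\<le>m. f (p + i) = f p + i"
      then have "f (p + m) = f p + m" "f (p + j) = f p + j" using Suc by auto
      then have "f (p + Suc m) = f p + Suc m" using step ne Suc by linarith
      with up show ?thesis by (auto simp: le_Suc_eq)
    next
      assume down: "\<forall>i\<le>m. f (p + i) + i = f p"
      then have "f (p + m) + m = f p" "f (p + j) + j = f p" using Suc by auto
      then have "f (p + Suc m) + Suc m = f p" using step ne Suc by linarith
      with down show ?thesis by (auto simp: le_Suc_eq)
    qed
  qed
qed

text \<open>By \<open>walk\<close> the map is a translation or a reflection on the block. Adjacency
  is also reflected by the map, so nothing outside the block can land next to its image.\<close>

lemma block_image:
  assumes f: "fiso n D f" and ab: "block D a b"
  shows "\<exists>c. block (f ` D) c (c + (b - a)) \<and> f ` {a<..<b} = {c<..<c + (b - a)} \<and>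
    ((\<forall>x\<in>{a<..<b}. f x + a = x + c) \<or> (\<forall>x\<in>{a<..<b}. f x + x = c + b))"
proof -
  let ?I = "{a<..<b}" and ?m = "b - a - 2"
  have I: "?I \<subseteq> D" "a \<notin> D" "b \<notin> D" "a + 1 < b" using ab by (auto simp: block_def)
  have pos: "f x \<ge> 1" if "x \<in> D" for x using f that by (auto simp: fiso_def X_def)
  have closed: "y \<in> ?I" if "z \<in> ?I" "y \<in> D" "f y = f z + 1 \<or> f z = f y + 1" for y z
  proof -
    have "y = z + 1 \<or> z = y + 1" using fiso_adj[OF f, of y z] that I by blast
    moreover have "y \<noteq> a" "y \<noteq> b" using that I by auto
    ultimately show ?thesis using that(1) by auto
  qed
  have a1: "a + 1 \<in> D" using I by auto
  have inI: "a + 1 + i \<in> ?I" if "i \<le> ?m" for i using that I by auto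
  have "(\<forall>i\<le>?m. f (a + 1 + i) = f (a + 1) + i) \<or> (\<forall>i\<le>?m. f (a + 1 + i) + i = f (a + 1))"
  proof (rule walk)
    fix i assume i: "i < ?m"
    then have "a + 1 + i \<in> D" "a + 1 + Suc i \<in> D" using inI[of i] inI[of "Suc i"] I by auto
    then show "f (a + 1 + Suc i) = f (a + 1 + i) + 1 \<or> f (a + 1 + i) = f (a + 1 + Suc i) + 1"
      using fiso_adj[OF f] by auto
  next
    have "{a + 1..a + 1 + ?m} \<subseteq> ?I" using I(4) by auto
    then have "{a + 1..a + 1 + ?m} \<subseteq> D" using I(1) by blast
    then show "inj_on f {a + 1..a + 1 + ?m}" using f inj_on_subset by (auto simp: fiso_def)
  qed
  then consider (up) "\<And>i. i \<le> ?m \<Longrightarrow> f (a + 1 + i) = f (a + 1) + i"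
    | (down) "\<And>i. i \<le> ?m \<Longrightarrow> f (a + 1 + i) + i = f (a + 1)" by blast
  then obtain c where c: "(\<forall>x\<in>?I. f x + a = x + c) \<or> (\<forall>x\<in>?I. f x + x = c + b)"
  proof cases
    case up
    have "f x + a = x + (f (a + 1) - 1)" if "x \<in> ?I" for x
      using up[of "x - (a + 1)"] that pos[OF a1] by auto
    then show ?thesis using that by blast
  next
    case down
    \<comment> \<open>The last point of the block has a positive image, so the subtraction defining
      the left gap is not truncated.\<close>
    have "f (a + 1) \<ge> b - a - 1" using down[of ?m] pos[of "a + 1 + ?m"] inI[of ?m] I by auto
    then have "f x + x = (f (a + 1) + a + 1 - b) + b" if x: "x \<in> ?I" for x
    proof -
      obtain i where "x = a + 1 + i" using x less_iff_Suc_add by auto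
      moreover from this have "f x + i = f (a + 1)" using x down[of i] by auto
      ultimately show ?thesis using \<open>f (a + 1) \<ge> b - a - 1\<close> I(4) by linarith
    qed
    then show ?thesis using that by blast
  qed
  have im: "f ` ?I = {c<..<c + (b - a)}"
  proof
    show "f ` ?I \<subseteq> {c<..<c + (b - a)}"
    proof
      fix y assume "y \<in> f ` ?I"
      then obtain x where "x \<in> ?I" "y = f x" by blast
      with c have "y + a = x + c \<or> y + x = c + b" by blast
      with \<open>x \<in> ?I\<close> show "y \<in> {c<..<c + (b - a)}" by auto
    qed
    show "{c<..<c + (b - a)} \<subseteq> f ` ?I"
    proof
      fix y assume y: "y \<in> {c<..<c + (b - a)}"
      from c show "y \<in> f ` ?I"
      proof
        assume *: "\<forall>x\<in>?I. f x + a = x + c"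
        have "y - c + a \<in> ?I" using y by auto
        with * have "y = f (y - c + a)" using y by fastforce
        with \<open>y - c + a \<in> ?I\<close> show ?thesis by (rule rev_image_eqI)
      next
        assume *: "\<forall>x\<in>?I. f x + x = c + b"
        have "c + b - y \<in> ?I" using y by auto
        with * have "y = f (c + b - y)" using y by fastforce
        with \<open>c + b - y \<in> ?I\<close> show ?thesis by (rule rev_image_eqI)
      qed
    qed
  qed
  \<comment> \<open>A preimage of such a \<open>d\<close> would be adjacent to a point of the block,
    hence in the block by \<open>closed\<close>.\<close>
  have gap: "d \<notin> f ` D" if d: "d = c \<or> d = c + (b - a)" for d
  proof
    assume "d \<in> f ` D"
    then obtain y where y: "y \<in> D" "d = f y" by blast
    have "c + 1 \<in> f ` ?I" "c + (b - a) - 1 \<in> f ` ?I" unfolding im using I by auto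
    then obtain z w where "z \<in> ?I" "f z = c + 1" "w \<in> ?I" "f w = c + (b - a) - 1"
      by (metis imageE)
    moreover have "c + (b - a) = c + (b - a) - 1 + 1" using I(4) by simp
    ultimately have "y \<in> ?I" using closed[of z y] closed[of w y] y d by metis
    then have "d \<in> {c<..<c + (b - a)}" using y im by blast
    with d show False by auto
  qed
  have "block (f ` D) c (c + (b - a))"
    unfolding block_def using gap I im[symmetric] by auto
  with im c show ?thesis by blast
qed

text \<open>If \<open>a\<close> has the parity of \<open>k\<close> and \<open>b\<close> does not, two reversals are needed, and the hypothesis
  on the blocks starting at \<open>k\<close> provides the intermediate gap \<open>u\<close>.\<close>

lemma ex_front:
  assumes D: "D \<subseteq> X n" and ab: "block D a b" "k \<le> a" "k \<notin> D"
    and par: "even b = even k \<or> (even a = even k \<and> (\<forall>c. block D k c \<longrightarrow> even c \<noteq> even k))"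
  shows "\<exists>g. generated g D \<and> pinned k D g \<and> g ` {a<..<b} = {k<..<k + (b - a)} \<and> k + (b - a) \<notin> g ` D"
proof -
  have ab': "a \<notin> D" "b \<notin> D" "a + 1 < b" "b \<le> n + 1" using ab block_le[OF D] by (auto simp: block_def)
  have flipim: "flip u b ` {a<..<b} = {u<..<u + (b - a)}" if "u \<le> a" for u
  proof -
    have "x \<in> flip u b ` {a<..<b} \<longleftrightarrow> x \<in> {u<..<u + (b - a)}" for x
      unfolding in_flip_image using that ab' by (auto simp: flip_def)
    then show ?thesis by blast
  qed
  have flipgap: "u + (b - a) \<notin> flip u b ` D" if "u \<le> a" "u \<notin> D" for u
  proof -
    \<comment> \<open>The point just after the moved block comes from one of the two old bounding
      gaps.\<close>
    have "flip u b (u + (b - a)) = (if u = a then b else a)" using that ab' by (auto simp: flip_def)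
    then show ?thesis unfolding in_flip_image using ab' by simp
  qed
  show ?thesis
  proof (cases "even b = even k")
    case True
    have "generated (flip k b) D" using D ab ab' True by (intro generated_flip) auto
    moreover have "pinned k D (flip k b)" using D ab ab' True by (intro pinned_flip) auto
    ultimately show ?thesis using flipim[OF ab(2)] flipgap[OF ab(2,3)] by blast
  next
    case False
    with par have a: "even a = even k" and nb: "\<And>c. block D k c \<Longrightarrow> even c \<noteq> even k" by blast+
    show ?thesis
    proof (cases "a = k")
      case True
      have "generated id D" using D by (rule generated_id)
      moreover have "pinned k D id" using D ab by (auto simp: pinned_def fiso_def)
      ultimately show ?thesis using True ab' by (intro exI[of _ id]) auto
    next
      case False
      \<comment> \<open>If \<open>k + 1\<close> is a gap, it serves. Otherwise the right end of the
        block starting at \<open>k\<close> does: its parity is right by \<open>nb\<close>, and it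
        lies before the gap \<open>a\<close>.\<close>
      obtain u where u: "k < u" "u < a" "u \<notin> D" "even u \<noteq> even k"
      proof (cases "k + 1 \<in> D")
        case True
        then obtain a' c where c: "block D a' c" "k \<le> a'" "a' < k + 1" "k + 1 < c"
          using ex_block[OF D True ab(3)] by auto
        then have "block D k c" by (simp add: le_less_Suc_eq)
        have "a \<notin> {a'<..<c}" using c(1) ab'(1) by (auto simp: block_def)
        then have "\<not> a < c" using c ab(2) False by auto
        moreover have "c \<noteq> a" using nb[OF \<open>block D k c\<close>] a by auto
        ultimately show ?thesis using that[of c] c nb[OF \<open>block D k c\<close>] by (auto simp: block_def)
      next
        case False
        have "k + 1 \<noteq> a" using a by auto
        with False show ?thesis using that[of "k + 1"] \<open>a \<noteq> k\<close> ab(2) by auto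
      qed
      \<comment> \<open>\<open>?f\<close> puts the block right after \<open>u\<close>, so that it
        ends at the gap \<open>?e\<close>. Since \<open>u\<close> has the parity of
        \<open>b\<close>, \<open>?e\<close> has that of \<open>k\<close>, and \<open>?g\<close> can
        move the block to the front.\<close>
      let ?f = "flip u b" let ?e = "u + (b - a)" let ?g = "flip k ?e"
      have pb: "even u = even b" using u \<open>even b \<noteq> even k\<close> by blast
      have pe: "even k = even ?e" using u pb a ab' by auto
      have f1: "generated ?f D" using D u ab' pb by (intro generated_flip) auto
      have f2: "pinned k D ?f" using D u ab ab' pb by (intro pinned_flip) auto
      have DX: "?f ` D \<subseteq> X n" using f2 by (auto simp: pinned_def fiso_def)
      have kf: "k \<notin> ?f ` D" using f2 by (rule pinned_image)
      have ef: "?e \<notin> ?f ` D" using flipgap u by simp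
      have g1: "generated ?g (?f ` D)" using DX kf ef pe u ab' by (intro generated_flip) auto
      have g2: "pinned k (?f ` D) ?g" using DX kf ef pe u ab' by (intro pinned_flip) auto
      have "?g ` {u<..<?e} = {k<..<k + (b - a)}"
      proof -
        have "x \<in> ?g ` {u<..<?e} \<longleftrightarrow> x \<in> {k<..<k + (b - a)}" for x
          unfolding in_flip_image using u ab' by (auto simp: flip_def)
        then show ?thesis by blast
      qed
      then have im: "(?g \<circ> ?f) ` {a<..<b} = {k<..<k + (b - a)}"
        unfolding image_comp[symmetric] using flipim[of u] u by simp
      have "?g (k + (b - a)) = u" using u ab' by (auto simp: flip_def)
      then have "k + (b - a) \<notin> (?g \<circ> ?f) ` D"
        unfolding image_comp[symmetric] in_flip_image using u by simp
      then show ?thesis using generated_comp[OF f1 g1] pinned_comp[OF f2 g2] im by blast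
    qed
  qed
qed

text \<open>Compare parities at \<open>a + 1\<close>: a translation gives \<open>c\<close> the
  parity of \<open>a\<close>, a reflection that of \<open>b\<close>, and these agree when
  \<open>b - a\<close> is even.\<close>

lemma pinned_block_image:
  assumes f: "pinned k D f" and ab: "block D a b" "k \<le> a"
  obtains c where "block (f ` D) c (c + (b - a))" "f ` {a<..<b} = {c<..<c + (b - a)}" "k \<le> c"
    "even (b - a) \<Longrightarrow> even c = even a"
proof -
  have fi: "fiso n D f" using f by (simp add: pinned_def)
  obtain c where c: "block (f ` D) c (c + (b - a))" "f ` {a<..<b} = {c<..<c + (b - a)}"
    and d: "(\<forall>x\<in>{a<..<b}. f x + a = x + c) \<or> (\<forall>x\<in>{a<..<b}. f x + x = c + b)"
    using block_image[OF fi ab(1)] by blast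
  have I: "{a<..<b} \<subseteq> D" "a + 1 < b" using ab by (auto simp: block_def)
  have "c + 1 \<in> f ` {a<..<b}" unfolding c(2) using I by auto
  then obtain x where x: "x \<in> {a<..<b}" "f x = c + 1" by (metis imageE)
  have "k < x" "x \<in> D" using x ab I by auto
  then have "k < f x" using f by (auto simp: pinned_def)
  then have "k \<le> c" using x by simp
  have a1: "a + 1 \<in> {a<..<b}" using I by auto
  then have ev: "even (f (a + 1)) = even (a + 1)" using f I by (auto simp: pinned_def)
  have "even c = even a" if "even (b - a)"
  proof -
    have "even a = even b" using that I by auto
    moreover have "f (a + 1) + a = a + 1 + c \<or> f (a + 1) + (a + 1) = c + b" using d a1 by blast
    ultimately show ?thesis using ev by presburger
  qed
  with c \<open>k \<le> c\<close> show ?thesis using that by blast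
qed

section \<open>Settling one block after another\<close>

text \<open>With the block and its image both moved to the front, the conjugated map sends the first
  block to itself. After a possible reversal it is the identity there, and the induction hypothesis
  applies at the next gap \<open>?k\<close>.\<close>

lemma pinned_step:
  assumes f: "pinned k D f"
    and IH: "\<forall>k' D' F. k < k' \<longrightarrow> k' \<le> n + 1 \<longrightarrow> pinned k' D' F \<longrightarrow> generated F D'"
    and ab: "block D a b" "k \<le> a"
    and parD: "even b = even k \<or> (even a = even k \<and> (\<forall>c. block D k c \<longrightarrow> even c \<noteq> even k))"
    and c: "block (f ` D) c (c + (b - a))" "f ` {a<..<b} = {c<..<c + (b - a)}" "k \<le> c"
    and parE: "even (c + (b - a)) = even k \<or>
      (even c = even k \<and> (\<forall>d. block (f ` D) k d \<longrightarrow> even d \<noteq> even k))"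
  shows "generated f D"
proof -
  have D: "D \<subseteq> X n" "f ` D \<subseteq> X n" "k \<notin> D" "k \<notin> f ` D"
    using f pinned_image[OF f] by (auto simp: pinned_def fiso_def)
  have I: "{a<..<b} \<subseteq> D" "a + 1 < b" using ab by (auto simp: block_def)
  let ?k = "k + (b - a)"
  have kk: "k < ?k" "k + 1 < ?k" using I by auto
  obtain g where g: "generated g D" "pinned k D g" "g ` {a<..<b} = {k<..<?k}" "?k \<notin> g ` D"
    using ex_front[OF D(1) ab D(3) parD] by blast
  obtain h where h: "generated h (f ` D)" "pinned k (f ` D) h"
    "h ` {c<..<c + (b - a)} = {k<..<?k}" "?k \<notin> h ` f ` D"
    using ex_front[OF D(2) c(1,3) D(4) parE] by auto
  let ?D = "g ` D" and ?F = "h \<circ> f \<circ> inv_into D g"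
  have inj: "inj_on g D" using g(2) by (simp add: pinned_def fiso_def)
  have inv: "inv_into D g ` ?D = D" using inj by (simp add: inv_into_image_cancel)
  have F: "pinned k ?D ?F"
  proof -
    have fg: "pinned k ?D (f \<circ> inv_into D g)"
      by (rule pinned_comp[OF pinned_inv[OF g(2)]]) (simp only: inv f)
    show ?thesis
      unfolding comp_assoc by (rule pinned_comp[OF fg]) (simp only: image_comp[symmetric] inv h(2))
  qed
  have Fim: "?F ` {k<..<?k} = {k<..<?k}"
  proof -
    have "inv_into D g ` {k<..<?k} = {a<..<b}"
      unfolding g(3)[symmetric] by (rule inv_into_image_cancel[OF inj I(1)])
    then show ?thesis unfolding image_comp[symmetric] c(2) h(3) by (simp only: c(2) h(3))
  qed
  have FD: "?k \<notin> ?F ` ?D" using h(4) by (simp only: image_comp[symmetric] inv not_False_eq_True)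
  have sub: "{k<..<?k} \<subseteq> ?D" unfolding g(3)[symmetric] using I(1) by blast
  have kD: "k \<notin> ?D" by (rule pinned_image[OF g(2)])
  have blk: "block ?D k ?k" using sub kD g(4) kk by (simp add: block_def)
  have Ffi: "fiso n ?D ?F" using F by (simp add: pinned_def)
  have k'n: "?k \<le> n + 1"
    using block_le[OF _ blk] g(2) by (auto simp: pinned_def fiso_def)
  obtain d where d: "?F ` {k<..<?k} = {d<..<d + (?k - k)}"
    "(\<forall>x\<in>{k<..<?k}. ?F x + k = x + d) \<or> (\<forall>x\<in>{k<..<?k}. ?F x + x = d + ?k)"
    using block_image[OF Ffi blk] by blast
  have "d = k"
  proof -
    have eq: "{k<..<?k} = {d<..<d + (?k - k)}" using d(1) Fim by simp
    have "k + 1 \<in> {k<..<?k}" "d + 1 \<in> {d<..<d + (?k - k)}" using kk by auto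
    then have "k + 1 \<in> {d<..<d + (?k - k)}" "d + 1 \<in> {k<..<?k}" using eq by blast+
    then show ?thesis by auto
  qed
  then have cases: "(\<forall>x\<in>{k<..<?k}. ?F x = x) \<or> (\<forall>x\<in>{k<..<?k}. ?F x + x = k + ?k)"
    using d(2) by simp
  have fin: "generated F ?D"
    if F: "pinned k ?D F" "\<forall>x\<in>{k<..<?k}. F x = x" "?k \<notin> F ` ?D" for F
  proof (rule IH[rule_format, OF kk(1) k'n])
    have "F x = x" if "x \<in> ?D" "x \<le> ?k" for x
    proof -
      have "x \<noteq> ?k" using that(1) g(4) by blast
      then have "x \<le> k \<or> x \<in> {k<..<?k}" using that by auto
      then show ?thesis using F(1,2) that(1) by (auto simp: pinned_def)
    qed
    moreover have "?k < F x" if x: "x \<in> ?D" "?k < x" for x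
    proof (rule ccontr)
      assume "\<not> ?k < F x"
      moreover have "k < F x" using F(1) x by (auto simp: pinned_def)
      \<comment> \<open>The remaining possibility, landing inside the front block, contradicts
        injectivity because the points of that block are fixed.\<close>
      moreover have "F x \<noteq> ?k" using F(3) imageI[OF x(1), of F] by metis
      ultimately have "F x \<in> {k<..<?k}" by auto
      then have "F (F x) = F x" "F x \<in> ?D" using F(2) sub by blast+
      moreover have "inj_on F ?D" using F(1) by (simp add: pinned_def fiso_def)
      ultimately have "F x = x" using x(1) by (metis inj_onD)
      with \<open>F x \<in> {k<..<?k}\<close> x show False by auto
    qed
    ultimately show "pinned ?k ?D F" using F(1) g(4) by (auto simp: pinned_def)
  qed
  from cases have "generated ?F ?D"
  proof
    assume "\<forall>x\<in>{k<..<?k}. ?F x = x"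
    then show ?thesis using fin F FD by blast
  next
    assume refl: "\<forall>x\<in>{k<..<?k}. ?F x + x = k + ?k"
    let ?R = "flip k ?k" and ?G = "flip k ?k \<circ> ?F"
    have k1: "k + 1 \<in> {k<..<?k}" using kk by auto
    \<comment> \<open>A reflection that preserves parity has an even sum of ends, so the segment
      between \<open>k\<close> and \<open>?k\<close> may be reversed.\<close>
    then have "even (?F (k + 1)) = even (k + 1)" by (intro pinnedD(3)[OF F] subsetD[OF sub])
    then have "even (?F (k + 1) + (k + 1))" unfolding even_add by blast
    moreover have "?F (k + 1) + (k + 1) = k + ?k" using refl k1 by blast
    ultimately have "even (k + ?k)" by (simp only:)
    then have par: "even k = even ?k" unfolding even_add by blast
    have FX: "?F ` ?D \<subseteq> X n" using Ffi by (simp only: fiso_def)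
    have kF: "k \<notin> ?F ` ?D" by (rule pinned_image[OF F])
    have R: "pinned k (?F ` ?D) ?R"
      by (rule pinned_flip[OF FX kF FD par k'n order_refl kF])
    have Rk: "?R ` ?F ` ?D \<subseteq> X n" "k \<notin> ?R ` ?F ` ?D" "?k \<notin> ?R ` ?F ` ?D"
      using pinnedD(1)[OF R] kF FD unfolding in_flip_image flip_end by (simp_all only: fiso_def not_False_eq_True)
    have G: "pinned k ?D ?G" by (rule pinned_comp[OF F R])
    have "?G x = x" if x: "x \<in> {k<..<?k}" for x
    proof -
      have "?F x + x = k + ?k" using refl x by blast
      then have Fx: "?F x = k + ?k - x" by (rule add_implies_diff)
      have "flip k ?k (k + ?k - x) = x" using x by (auto simp: flip_def)
      then show ?thesis using Fx by (simp only: o_apply)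
    qed
    moreover have "?k \<notin> ?G ` ?D" using Rk(3) by (simp only: image_comp[symmetric] not_False_eq_True)
    ultimately have "generated ?G ?D" using fin[OF G] by blast
    moreover have "generated ?R (?G ` ?D)"
      using generated_flip[OF Rk par kk(1) k'n] by (simp only: image_comp[symmetric])
    ultimately have "generated (?R \<circ> ?G) ?D" by (rule generated_comp)
    then show ?thesis by (rule generated_cong) (simp only: o_apply flip_flip)
  qed
  then show ?thesis by (rule generated_conj[OF g(1) h(1)])
qed

text \<open>Odd blocks whose gaps have the parity of \<open>k\<close> go first, then even blocks. If
  only odd blocks with gaps of the other parity remain, \<open>k + 1\<close> is a gap on both sides,
  and advancing \<open>k\<close> by one switches the parity.\<close>

lemma pinned_generated: "pinned k D f \<Longrightarrow> k \<le> n + 1 \<Longrightarrow> generated f D"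
proof (induction "n + 1 - k" arbitrary: k D f rule: less_induct)
  case less
  note f = less.prems(1)
  have IH: "\<forall>k' D' F. k < k' \<longrightarrow> k' \<le> n + 1 \<longrightarrow> pinned k' D' F \<longrightarrow> generated F D'"
  proof (intro allI impI)
    fix k' D' F assume k': "k < k'" "k' \<le> n + 1" "pinned k' D' F"
    then have "n + 1 - k' < n + 1 - k" by simp
    then show "generated F D'" using k'(3,2) by (rule less.hyps)
  qed
  have D: "D \<subseteq> X n" "f ` D \<subseteq> X n" "k \<notin> D" "k \<notin> f ` D" "inj_on f D"
    using f pinned_image[OF f] by (auto simp: pinned_def fiso_def)
  let ?P = "\<lambda>D a b. block D a b \<and> k \<le> a \<and> even a = even k \<and> even b = even k"
  show ?case
  proof (cases "\<exists>a b. ?P D a b")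
    case True
    then obtain a b where ab: "?P D a b" by blast
    then have lt: "a < b" by (auto simp: block_def)
    obtain c where c: "block (f ` D) c (c + (b - a))" "f ` {a<..<b} = {c<..<c + (b - a)}" "k \<le> c"
      and ev: "even (b - a) \<Longrightarrow> even c = even a"
      using pinned_block_image[OF f] ab by metis
    have "even (b - a)" using ab lt by auto
    with ev ab have "even (c + (b - a)) = even k" by auto
    then show ?thesis using pinned_step[OF f IH] ab c by blast
  next
    case nD: False
    \<comment> \<open>Applying the block lemma to the inverse map turns the absence of a kind of
      block in the domain into its absence in the range.\<close>
    have pull: "\<exists>c. block D c (c + (b - a)) \<and> k \<le> c \<and> (even (b - a) \<longrightarrow> even c = even a)"
      if "block (f ` D) a b" "k \<le> a" for a b
      using pinned_block_image[OF pinned_inv[OF f] that] inv_into_image_cancel[OF D(5) order_refl]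
      by metis
    have nE: "\<not> ?P (f ` D) a b" for a b
    proof
      assume P: "?P (f ` D) a b"
      then have "a < b" by (auto simp: block_def)
      then have "even (b - a)" using P by auto
      then obtain c where "block D c (c + (b - a))" "k \<le> c" "even c = even a" using pull P by blast
      then have "?P D c (c + (b - a))" using P \<open>even (b - a)\<close> by auto
      with nD show False by blast
    qed
    show ?thesis
    proof (cases "\<exists>a b. block D a b \<and> k \<le> a \<and> odd (b - a)")
      case True
      then obtain a b where ab: "block D a b" "k \<le> a" "odd (b - a)" by blast
      obtain c where c: "block (f ` D) c (c + (b - a))" "f ` {a<..<b} = {c<..<c + (b - a)}" "k \<le> c"
        using pinned_block_image[OF f ab(1,2)] by metis
      \<comment> \<open>One of the two gaps has the parity of \<open>k\<close>. If it is
        \<open>a\<close>, the second alternative holds because no odd block starts at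
        \<open>k\<close> any more.\<close>
      have "even b \<noteq> even a" using ab by (auto simp: block_def)
      moreover have "even d \<noteq> even k" if "block D k d" for d using nD that by auto
      ultimately have 1: "even b = even k \<or> (even a = even k \<and> (\<forall>c. block D k c \<longrightarrow> even c \<noteq> even k))"
        by blast
      have "even (c + (b - a)) \<noteq> even c" using ab(3) unfolding even_add by blast
      moreover have "even d \<noteq> even k" if "block (f ` D) k d" for d using nE[of k d] that by auto
      ultimately have 2: "even (c + (b - a)) = even k \<or>
          (even c = even k \<and> (\<forall>d. block (f ` D) k d \<longrightarrow> even d \<noteq> even k))"
        by blast
      show ?thesis by (rule pinned_step[OF f IH ab(1,2) 1 c 2])
    next
      case nO: False
      show ?thesis
      proof (cases "\<exists>x\<in>D. k < x")
        case False
        have "generated id D" by (rule generated_id[OF D(1)])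
        then show ?thesis
          by (rule generated_cong) (use pinnedD(4)[OF f] False in \<open>simp add: not_less\<close>)
      next
        case True
        \<comment> \<open>A block starting at \<open>k\<close> would now be odd with both gaps of
          the parity of \<open>k\<close>, which is excluded.\<close>
        have D1: "k + 1 \<notin> D"
        proof
          assume "k + 1 \<in> D"
          then obtain a b where ab: "block D a b" "k \<le> a" "a < k + 1"
            using ex_block[OF D(1) \<open>k + 1 \<in> D\<close> D(3) less_add_one] by blast
          then have "a = k" by simp
          have "a < b" using ab by (simp add: block_def)
          moreover have "even (b - a)" using nO ab by blast
          ultimately have "?P D a b" using ab \<open>a = k\<close> by auto
          with nD show False by blast
        qed
        have E1: "k + 1 \<notin> f ` D"
        proof
          assume "k + 1 \<in> f ` D"
          then obtain a b where ab: "block (f ` D) a b" "k \<le> a" "a < k + 1"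
            using ex_block[OF D(2) \<open>k + 1 \<in> f ` D\<close> D(4) less_add_one] by blast
          then have "a = k" by simp
          obtain c where "block D c (c + (b - a))" "k \<le> c" using pull ab by blast
          then have "even (c + (b - a) - c)" using nO by blast
          then have "even (b - a)" by simp
          moreover have "a < b" using ab by (auto simp: block_def)
          ultimately have "?P (f ` D) a b" using ab \<open>a = k\<close> by auto
          with nE show False by blast
        qed
        have le: "x \<le> k" if "x \<in> D" "x \<le> k + 1" for x
          using that D1 le_Suc_eq by auto
        have lt: "k + 1 < f x" if "x \<in> D" "k < x" for x
        proof -
          have "k < f x" by (rule pinnedD(5)[OF f that])
          moreover have "f x \<noteq> k + 1" using E1 imageI[OF that(1), of f] by metis
          ultimately show ?thesis by simp
        qed
        have "pinned (k + 1) D f"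
          by (rule pinnedI) (use pinnedD[OF f] D1 le lt in simp_all)
        moreover have "k + 1 \<le> n + 1" using True D(1) by (auto simp: X_def)
        ultimately show ?thesis using IH less_add_one by blast
      qed
    qed
  qed
qed

section \<open>Removing isolated even points\<close>

definition isolated :: "nat set \<Rightarrow> nat \<Rightarrow> bool" where
  "isolated D x \<longleftrightarrow> x \<in> D \<and> (\<forall>y\<in>D. \<not> (x = y + 1 \<or> y = x + 1))"

lemma isolated_image:
  assumes "fiso n D f" "x \<in> D" shows "isolated (f ` D) (f x) \<longleftrightarrow> isolated D x"
  by (simp add: isolated_def assms(2) fiso_adj[OF assms, simplified] cong: ball_cong)

text \<open>Induction on the number of isolated even points: a reversal moves one of them to
  \<open>n\<close>, and \<open>sigma2\<close> then sends it to \<open>1\<close> while all other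
  parities are kept.\<close>

lemma ex_odd_isolated:
  "D \<subseteq> X n \<Longrightarrow> \<exists>g. generated g D \<and> (\<forall>x. isolated (g ` D) x \<longrightarrow> odd x)"
proof (induction "card {x. isolated D x \<and> even x}" arbitrary: D rule: less_induct)
  case less
  let ?I = "\<lambda>D. {x. isolated D x \<and> even x}"
  have D: "D \<subseteq> X n" by (rule less.prems)
  have fin: "finite (?I D)"
    by (rule finite_subset[of _ "X n"]) (use D in \<open>auto simp: isolated_def X_def\<close>)
  show ?case
  proof (cases "?I D = {}")
    case True
    then have "\<forall>x. isolated (id ` D) x \<longrightarrow> odd x" by auto
    then show ?thesis using generated_id[OF D] by blast
  next
    case False
    then obtain x where x: "isolated D x" "even x" by blast
    have "x \<in> D" using x by (simp add: isolated_def)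
    then have xX: "1 \<le> x" "x \<le> n" using D by (auto simp: X_def)
    then have x2: "2 \<le> x" using x(2) by presburger
    let ?u = "x - 1" and ?s = "gen_fun (n - 1)"
    let ?f = "flip ?u (n + 1)"
    have u: "?u \<notin> D" "odd ?u" "?u \<le> n" "?u < n + 1" "even ?u = even (n + 1)"
      using x xX x2 n by (auto simp: isolated_def)
    have x1: "x + 1 \<notin> D" using x by (auto simp: isolated_def)
    have n12: "n - 1 \<noteq> 2" using n by presburger
    have f: "generated ?f D" by (rule generated_flip_n[OF D u(1-3)])
    \<comment> \<open>The neighbour of \<open>n\<close> comes from a neighbour of the isolated point
      \<open>x\<close>, so the domain of \<open>sigma2\<close> contains the whole image.\<close>
    have "n - 1 \<notin> ?f ` D"
    proof -
      have "?f (n - 1) = (if x = n then ?u else x + 1)" using xX x2 by (auto simp: flip_def)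
      then have "?f (n - 1) \<notin> D" using u(1) x1 by (cases "x = n") simp_all
      then show ?thesis unfolding in_flip_image .
    qed
    moreover have "?f ` D \<subseteq> X n" using generated_fiso[OF f] by (simp add: fiso_def)
    ultimately have "?f ` D \<subseteq> X n - {n - 1}" by blast
    then have s: "generated ?s (?f ` D)"
      by (rule generated_subset[OF generated_gen[of "n - 1"], rotated]) (use n2 in \<open>simp add: X_def\<close>)
    define g where "g = ?s \<circ> ?f"
    have g: "generated g D" unfolding g_def by (rule generated_comp[OF f s])
    have gi: "fiso n D g" by (rule generated_fiso[OF g])
    have "?f x = n" using xX x2 by (auto simp: flip_def)
    then have gx: "g x = 1" using n12 by (simp add: g_def gen_fun_def)
    have gy: "even (g y) = even y" if "y \<in> D" "y \<noteq> x" for y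
    proof -
      have "?f y \<noteq> n" using \<open>?f x = n\<close> that(2) by (metis flip_flip)
      then have "g y = ?f y + 2" using n12 by (simp add: g_def gen_fun_def)
      then show ?thesis using flip_parity[OF u(5)] by simp
    qed
    have "?I (g ` D) \<subseteq> g ` (?I D - {x})"
    proof
      fix z assume z: "z \<in> ?I (g ` D)"
      then obtain y where y: "y \<in> D" "z = g y" by (auto simp: isolated_def)
      have "y \<noteq> x" using z y gx by auto
      moreover have "isolated D y" using z y isolated_image[OF gi y(1)] by simp
      ultimately have "y \<in> ?I D - {x}" using z y gy[OF y(1)] by simp
      then show "z \<in> g ` (?I D - {x})" using y(2) by blast
    qed
    then have "card (?I (g ` D)) \<le> card (?I D - {x})" using fin by (intro surj_card_le) auto
    also have "\<dots> < card (?I D)" using fin x by (intro card_Diff1_less) auto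
    finally have "card (?I (g ` D)) < card (?I D)" .
    moreover have "g ` D \<subseteq> X n" using gi by (simp add: fiso_def)
    ultimately obtain h where h: "generated h (g ` D)" "\<forall>x. isolated (h ` g ` D) x \<longrightarrow> odd x"
      using less.hyps by blast
    then show ?thesis using generated_comp[OF g h(1)] by (intro exI[of _ "h \<circ> g"]) (simp add: image_comp)
  qed
qed

text \<open>A point with a neighbour in the domain shows its parity by being the lower or the upper
  one of the pair; isolated points and their images are odd by assumption.\<close>

lemma parity_of_odd_isolated:
  assumes f: "fiso n D f" and D: "\<And>x. isolated D x \<Longrightarrow> odd x" "\<And>x. isolated (f ` D) x \<Longrightarrow> odd x"
    and x: "x \<in> D"
  shows "even (f x) = even x"
proof (cases "isolated D x")
  case True
  then show ?thesis using D isolated_image[OF f x] by blast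
next
  case False
  then obtain y where y: "y \<in> D" "x = y + 1 \<or> y = x + 1" using x unfolding isolated_def by blast
  have "x \<in> X n" "y \<in> X n" using f x y by (auto simp: fiso_def)
  then have "fence_less n x y \<longleftrightarrow> odd x" using y(2) by (auto simp: fence_less_def)
  moreover have "f x \<in> X n" "f y \<in> X n" using f x y by (auto simp: fiso_def)
  then have "fence_less n (f x) (f y) \<longleftrightarrow> odd (f x)"
    using fiso_adj[OF f x y(1)] y(2) by (auto simp: fence_less_def)
  moreover have "fence_less n x y \<longleftrightarrow> fence_less n (f x) (f y)"
    using f x y(1) by (simp add: fiso_def)
  ultimately show ?thesis by blast
qed

lemma fiso_generated:
  assumes f: "fiso n D f" shows "generated f D"
proof -
  have D: "D \<subseteq> X n" "f ` D \<subseteq> X n" using f by (simp_all add: fiso_def)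
  obtain g where g: "generated g D" "\<forall>x. isolated (g ` D) x \<longrightarrow> odd x"
    using ex_odd_isolated[OF D(1)] by blast
  obtain h where h: "generated h (f ` D)" "\<forall>x. isolated (h ` f ` D) x \<longrightarrow> odd x"
    using ex_odd_isolated[OF D(2)] by blast
  let ?D = "g ` D" and ?F = "h \<circ> f \<circ> inv_into D g"
  have gi: "fiso n D g" "fiso n (f ` D) h" using g h generated_fiso by blast+
  then have "inj_on g D" by (simp add: fiso_def)
  then have inv: "inv_into D g ` ?D = D" by (simp add: inv_into_image_cancel)
  have "fiso n ?D (f \<circ> inv_into D g)"
    by (rule fiso_comp[OF fiso_inv[OF gi(1)]]) (simp only: inv f)
  then have F: "fiso n ?D ?F"
    unfolding comp_assoc by (rule fiso_comp) (simp only: image_comp[symmetric] inv gi(2))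
  have "?F ` ?D = h ` f ` D" by (simp only: image_comp[symmetric] inv)
  then have par: "even (?F x) = even x" if "x \<in> ?D" for x
    using parity_of_odd_isolated[OF F _ _ that] g(2) h(2) by metis
  have X: "1 \<le> x" if "x \<in> X n" for x using that by (simp add: X_def)
  \<comment> \<open>The induction starts at the artificial gap \<open>0\<close>, where nothing has
    to be settled yet.\<close>
  have "pinned 0 ?D ?F"
  proof (rule pinnedI[OF F _ par])
    show "0 \<notin> ?D" using gi(1) X by (fastforce simp: fiso_def)
    fix x assume x: "x \<in> ?D"
    then have "x \<in> X n" "?F x \<in> X n" using F unfolding fiso_def by blast+
    then show "x \<le> 0 \<Longrightarrow> ?F x = x" "0 < ?F x" using X by fastforce+
  qed
  then have "generated ?F ?D" by (rule pinned_generated) simp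
  then show ?thesis by (rule generated_conj[OF g(1) h(1)])
qed

lemma span_G: "semigroup_span (G n) = IF n"
proof
  show "semigroup_span (G n) \<subseteq> IF n" by (rule span_subset[OF G_subset])
  show "IF n \<subseteq> semigroup_span (G n)"
  proof
    fix \<alpha> assume "\<alpha> \<in> IF n"
    then have "fiso n (dom \<alpha>) (the \<circ> \<alpha>)" using pmap_in_IF[of "the \<circ> \<alpha>" "dom \<alpha>" n] by (simp add: pmap_dom)
    from fiso_generated[OF this] show "\<alpha> \<in> semigroup_span (G n)" by (simp add: pmap_dom)
  qed
qed

section \<open>Maps missing at most one point, and irreducibility of the generators\<close>

text \<open>Describes the maps missing at most one point, in a form that passes to products and so
  can be proved by induction over the span.\<close>

definition rank_cases :: "(nat \<rightharpoonup> nat) \<Rightarrow> bool" where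
  "rank_cases \<alpha> \<longleftrightarrow> dom \<alpha> \<subseteq> X n \<and> (dom \<alpha> = X n \<longrightarrow> \<alpha> = pmap id (X n)) \<and>
     (\<forall>i\<in>X n. dom \<alpha> = X n - {i} \<longrightarrow> \<alpha> = idem i \<or> \<alpha> = gen i)"

lemma pmult_id: "dom \<beta> \<subseteq> X n \<Longrightarrow> pmult (pmap id (X n)) \<beta> = \<beta>"
  by (auto simp: pmult_def pmap_def map_comp_def fun_eq_iff) (metis domIff subsetD)

lemma dom_pmult_left: "dom (pmult \<alpha> \<beta>) \<subseteq> dom \<alpha>"
  by (auto simp: pmult_def map_comp_def split: option.splits)

lemma dom_pmult_right: "A = dom (pmult (pmap f A) \<beta>) \<Longrightarrow> f ` A \<subseteq> dom \<beta>"
  by (auto simp: pmult_def pmap_def map_comp_def dom_def split: if_splits)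

lemma near_top: "X n - {i} \<subseteq> B \<Longrightarrow> B \<subseteq> X n \<Longrightarrow> B = X n \<or> B = X n - {i}"
  by blast

text \<open>No domain may be lost, so \<open>\<beta>\<close> is defined on \<open>X n - {i}\<close>.
  The second alternative also names the right factor, which \<open>G_irreducible\<close>
  uses.\<close>

lemma idem_mult:
  assumes i: "i \<in> X n" and b: "rank_cases \<beta>" and d: "dom (pmult (idem i) \<beta>) = X n - {i}"
  shows "pmult (idem i) \<beta> = idem i \<or> (\<beta> = gen i \<and> pmult (idem i) \<beta> = gen i)"
proof -
  have "X n - {i} \<subseteq> dom \<beta>" using dom_pmult_right[OF d[symmetric]] by simp
  then have "dom \<beta> = X n \<or> dom \<beta> = X n - {i}" using near_top b by (simp add: rank_cases_def)
  then consider "\<beta> = pmap id (X n)" | "\<beta> = idem i" | "\<beta> = gen i" using b i unfolding rank_cases_def by blast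
  then show ?thesis
    by cases (auto simp: pmult_pmap pmap_eq_iff)
qed

text \<open>The range of \<open>gen i\<close> misses only \<open>partner i\<close>, so
  \<open>\<beta>\<close> is an identity on that range or the inverse of
  \<open>gen i\<close>.\<close>

lemma gen_mult:
  assumes i: "i \<in> X n" and b: "rank_cases \<beta>" and d: "dom (pmult (gen i) \<beta>) = X n - {i}"
  shows "pmult (gen i) \<beta> = idem i \<or> pmult (gen i) \<beta> = gen i"
proof -
  let ?j = "partner i"
  have j: "?j \<in> X n" by (rule partner_in[OF i])
  have "X n - {?j} \<subseteq> gen_fun i ` (X n - {i})"
  proof
    fix y assume y: "y \<in> X n - {?j}"
    have "gen_fun i (gen_fun ?j y) = y" using gen_fun_partner[OF j y] by simp
    moreover have "gen_fun ?j y \<in> X n - {i}" using gen_fun_image[OF j y] by simp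
    ultimately show "y \<in> gen_fun i ` (X n - {i})" by (metis imageI)
  qed
  then have "X n - {?j} \<subseteq> dom \<beta>" using dom_pmult_right[OF d[symmetric]] by blast
  then have "dom \<beta> = X n \<or> dom \<beta> = X n - {?j}" using near_top b by (simp add: rank_cases_def)
  then consider "\<beta> = pmap id (X n)" | "\<beta> = idem ?j" | "\<beta> = gen ?j" using b j unfolding rank_cases_def by blast
  then show ?thesis
  proof cases
    case 3 then show ?thesis using idem_eq[OF i] by simp
  qed (use gen_fun_image[OF i] in \<open>auto simp: pmult_pmap pmap_eq_iff\<close>)
qed

lemma rank_cases_mult:
  assumes a: "rank_cases \<alpha>" and b: "rank_cases \<beta>" shows "rank_cases (pmult \<alpha> \<beta>)"
proof -
  have sub: "dom (pmult \<alpha> \<beta>) \<subseteq> dom \<alpha>" "dom \<alpha> \<subseteq> X n" "dom \<beta> \<subseteq> X n"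
    using dom_pmult_left a b by (auto simp: rank_cases_def)
  have full: "pmult \<alpha> \<beta> = \<beta>" if "dom \<alpha> = X n"
    using a that pmult_id[OF sub(3)] by (simp add: rank_cases_def)
  have "pmult \<alpha> \<beta> = pmap id (X n)" if "dom (pmult \<alpha> \<beta>) = X n"
  proof -
    have "dom \<alpha> = X n" using that sub by blast
    then show ?thesis using that full b by (simp add: rank_cases_def)
  qed
  moreover have "pmult \<alpha> \<beta> = idem i \<or> pmult \<alpha> \<beta> = gen i"
    if i: "i \<in> X n" and d: "dom (pmult \<alpha> \<beta>) = X n - {i}" for i
  proof -
    have "dom \<alpha> = X n \<or> dom \<alpha> = X n - {i}" by (rule near_top) (use sub d in auto)
    then consider "dom \<alpha> = X n" | "\<alpha> = idem i" | "\<alpha> = gen i"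
      using a i unfolding rank_cases_def by blast
    then show ?thesis
    proof cases
      case 1 then show ?thesis using full b i d unfolding rank_cases_def by metis
    next
      case 2 then show ?thesis using idem_mult[OF i b] d by metis
    next
      case 3 then show ?thesis using gen_mult[OF i b] d by metis
    qed
  qed
  ultimately show ?thesis using sub unfolding rank_cases_def by blast
qed

lemma rank_cases_IF: "\<alpha> \<in> IF n \<Longrightarrow> rank_cases \<alpha>"
  unfolding span_G[symmetric]
proof (induction rule: semigroup_span.induct)
  case (gen \<alpha>)
  then consider "\<alpha> = pmap id (X n)" | i where "i \<in> X n" "\<alpha> = gen i" by (auto simp: G_gen)
  then show ?case
  proof cases
    case 1 then show ?thesis by (auto simp: rank_cases_def)
  next
    case 2
    have "j = i" if "j \<in> X n" "X n - {j} = X n - {i}" for j using that 2(1) by blast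
    then show ?thesis using 2 by (auto simp: rank_cases_def)
  qed
qed (rule rank_cases_mult)

text \<open>The left factor misses at most the point missed by the product. If it is the identity or
  the generator itself, the claim is immediate; if it is \<open>idem i\<close>, then
  \<open>idem_mult\<close> forces the right factor to be the generator.\<close>

lemma G_irreducible:
  assumes u: "pmult \<alpha> \<beta> \<in> G n" and ab: "\<alpha> \<in> IF n" "\<beta> \<in> IF n"
  shows "\<alpha> = pmult \<alpha> \<beta> \<or> \<beta> = pmult \<alpha> \<beta>"
proof -
  have top: "rank_cases \<alpha>" "rank_cases \<beta>" using ab by (simp_all add: rank_cases_IF)
  then have sub: "dom (pmult \<alpha> \<beta>) \<subseteq> dom \<alpha>" "dom \<alpha> \<subseteq> X n" "dom \<beta> \<subseteq> X n"
    using dom_pmult_left by (auto simp: rank_cases_def)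
  have full: "pmult \<alpha> \<beta> = \<beta>" if "dom \<alpha> = X n"
    using top that pmult_id[OF sub(3)] by (simp add: rank_cases_def)
  from u consider "pmult \<alpha> \<beta> = pmap id (X n)" | i where "i \<in> X n" "pmult \<alpha> \<beta> = gen i"
    by (auto simp: G_gen)
  then show ?thesis
  proof cases
    case 1
    then have "dom \<alpha> = X n" using sub by auto
    then show ?thesis using full by simp
  next
    case 2
    then have d: "dom (pmult \<alpha> \<beta>) = X n - {i}" by simp
    have "dom \<alpha> = X n \<or> dom \<alpha> = X n - {i}" by (rule near_top) (use sub d in auto)
    then consider "dom \<alpha> = X n" | "\<alpha> = idem i" | "\<alpha> = gen i"
      using top 2(1) unfolding rank_cases_def by blast
    then show ?thesis
    proof cases
      case 1 then show ?thesis using full by simp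
    next
      case eq: 2
      have "gen i \<noteq> idem i" using gen_fun_not_id[OF 2(1)] by (simp add: pmap_eq_iff)
      then have "\<beta> = gen i" using idem_mult[OF 2(1) top(2)] d 2(2) eq by metis
      then show ?thesis using 2(2) by simp
    next
      case 3 then show ?thesis using 2(2) by simp
    qed
  qed
qed

text \<open>Induction over the span of \<open>A\<close>: a product lying in \<open>G n\<close>
  equals one of its factors, which is in \<open>A\<close> by the induction hypothesis.\<close>

lemma G_subset_generating:
  assumes "generating_set (IF n) A" shows "G n \<subseteq> A"
proof
  have A: "semigroup_span A = IF n" using assms by (simp add: generating_set_def)
  fix u assume "u \<in> G n"
  have "\<alpha> \<in> G n \<longrightarrow> \<alpha> \<in> A" if "\<alpha> \<in> semigroup_span A" for \<alpha>
    using that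
  proof induction
    case (mult \<alpha> \<beta>)
    show ?case
    proof
      assume "pmult \<alpha> \<beta> \<in> G n"
      then show "pmult \<alpha> \<beta> \<in> A" using G_irreducible[of \<alpha> \<beta>] mult A by metis
    qed
  qed simp
  then show "u \<in> A" using \<open>u \<in> G n\<close> G_subset A by blast
qed

end

theorem proposition4p3:
  fixes n :: nat
  assumes "n \<ge> 1" and "even n"
  shows "least_generating_set (IF n) (G n)"
proof -
  interpret even_fence n using assms by unfold_locales
  show ?thesis unfolding least_generating_set_def generating_set_def[of _ "G n"]
    using G_subset span_G G_subset_generating by blast
qed

end
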